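(* Let $n\ge 3$, let $J_n\in\mathcal{J}_n$ with parameters $c_1,\dots,c_{n-1}\in\mathbb{R}$, $b_1,\dots,b_n\in\mathbb{C}\setminus\{0\}$, $a_n\in\mathbb{C}$, let $J_{n-1}$ be its leading principal $(n-1)\times(n-1)$ submatrix with eigenvalues $\mu_1<\dots<\mu_{n-1}$, let $\chi_n(\lambda)=\det(\lambda I_n-J_n)$, and let $\beta=b_1b_2\cdots b_n$. Suppose that $\beta$ is real (necessarily nonzero). (1) If $a_n\in\mathbb{R}$, then all eigenvalues of $J_n$ are real and of multiplicity at most $2$, and any multiple eigenvalue of $J_n$ is an eigenvalue of $J_{n-1}$. (2) If $a_n\in\mathbb{C}\setminus\mathbb{R}$, then all eigenvalues of $J_n$ lie in the closed upper half-plane if $\operatorname{Im}a_n>0$, and in the closed lower half-plane if $\operatorname{Im}a_n<0$. Moreover, an eigenvalue of $J_n$ is real if and only if it is an eigenvalue of $J_{n-1}$. (3) If $a_n\in\mathbb{R}$ and $\lambda_1\le\dots\le\lambda_n$ are the eigenvalues of $J_n$ counted with multiplicity, then for $k=1,\dots,n-1$: if $\beta>0$, then $\lambda_k<\mu_k<\lambda_{k+1}$ when $n-k$ is odd and $\lambda_k\le\mu_k\le\lambda_{k+1}$ when $n-k$ is even; if $\beta<0$, then $\lambda_k\le\mu_k\le\lambda_{k+1}$ when $n-k$ is odd and $\lambda_k<\mu_k<\lambda_{k+1}$ when $n-k$ is even. (4) For every complex $a_n$ (real or nonreal), the numbers $\chi_n(\mu_k)$ are real and, for $k=1,\dots,n-1$: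 if $\beta>0$, then $(-1)^{n-k}\chi_n(\mu_k)>0$ when $n-k$ is odd and $(-1)^{n-k}\chi_n(\mu_k)\ge0$ when $n-k$ is even; if $\beta<0$, then $(-1)^{n-k}\chi_n(\mu_k)\ge0$ when $n-k$ is odd and $(-1)^{n-k}\chi_n(\mu_k)>0$ when $n-k$ is even.
   Context: For $n\ge 3$, $\mathcal{J}_n$ is the class of complex $n\times n$ matrices $$J_n=\begin{pmatrix} c_1 & b_1 & 0 &\dots& 0 & \overline{b}_n\\ \overline{b}_1 & c_2 & b_2 &\dots& 0 & 0\\ 0 & \overline{b}_2 & c_3 &\dots& 0 & 0\\ \vdots&\vdots&\vdots&\ddots&\vdots&\vdots\\ 0&0&0&\dots&c_{n-1}&b_{n-1}\\ b_n&0&0&\dots&\overline{b}_{n-1}&a_n \end{pmatrix},$$ i.e. the diagonal entries are $c_1,\dots,c_{n-1},a_n$; the $(k,k+1)$ entry is $b_k$ and the $(k+1,k)$ entry is $\overline{b}_k$ for $k=1,\dots,n-1$; the $(1,n)$ entry is $\overline{b}_n$ and the $(n,1)$ entry is $b_n$; all other entries are $0$. Here $c_1,\dots,c_{n-1}\in\mathbb{R}$, $b_1,\dots,b_n\in\mathbb{C}\setminus\{0\}$, $a_n\in\mathbb{C}$. The submatrix $J_{n-1}$ is self-adjoint with real simple eigenvalues, numbered in increasing order $\mu_1<\dots<\mu_{n-1}$. *)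

theory Defs
  imports "Jordan_Normal_Form.Spectral_Radius" "Jordan_Normal_Form.DL_Submatrix"
begin

text \<open>
  Row and column positions of library matrices start at 0, whereas the parameters
  carry the indices of the mathematical notation: \<open>c k\<close> matters for \<open>1 \<le> k \<le> n - 1\<close> only and
  \<open>b k\<close> for \<open>1 \<le> k \<le> n\<close> only. So \<open>i\<close> and \<open>j\<close> below are one less than the usual indices.
  The two corner entries do not collide with the off-diagonals provided \<open>3 \<le> n\<close>.
\<close>

definition J_mat :: "nat \<Rightarrow> (nat \<Rightarrow> real) \<Rightarrow> (nat \<Rightarrow> complex) \<Rightarrow> complex \<Rightarrow> complex mat" where
  "J_mat n c b a = mat n n (\<lambda>(i, j).
     if i = j then (if i = n - 1 then a else complex_of_real (c (i + 1)))
     else if j = i + 1 then b (i + 1)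
     else if i = j + 1 then cnj (b (j + 1))
     else if i = 0 \<and> j = n - 1 then cnj (b n)
     else if i = n - 1 \<and> j = 0 then b n
     else 0)"

definition leading_principal_submatrix :: "nat \<Rightarrow> 'a mat \<Rightarrow> 'a mat" where
  "leading_principal_submatrix m A = submatrix A {..<m} {..<m}"

text \<open>Algebraic multiplicity; it is 0 if \<open>z\<close> is not an eigenvalue.\<close>

definition eigenvalue_mult :: "complex mat \<Rightarrow> complex \<Rightarrow> nat" where
  "eigenvalue_mult A z = Polynomial.order z (char_poly A)"

end

theory Submission
  imports Defs
begin

text \<open>
  Let \<open>m = n - 1\<close>, and let \<open>S\<close> be the set of the \<open>m\<close> distinct real eigenvalues of the leading
  Jacobi matrix. Comparing values at the points of \<open>S\<close> (Lagrange interpolation) gives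
  \<open>\<chi>\<^sub>n(\<lambda>) = \<chi>\<^sub>m(\<lambda>) * (\<lambda> - a - (\<Sum>s\<in>S. r s / (\<lambda> - s)))\<close>, where \<open>r s = - \<chi>\<^sub>n(s) / \<chi>\<^sub>m'(s)\<close>.
  The whole theorem rests on the fact that these weights \<open>r s\<close> are real and nonnegative
  (\<open>char_poly_J_mat_eq_arrow_poly\<close>).

  Nonnegativity comes from the matrix. Expanding the determinant of the periodic matrix
  (\<open>char_poly_J_mat\<close>) shows that at \<open>s \<in> S\<close> the number \<open>- \<chi>\<^sub>n(s)\<close> is a sum \<open>x + y + 2 * \<beta>\<close>, where \<open>x\<close>
  and \<open>y\<close> are positive multiples of the characteristic polynomials of the Jacobi matrix without
  its first and without its last row and column. The Casoratian of the three-term recurrence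
  (\<open>jacobi_poly_casoratian\<close>) yields \<open>x * y = \<beta>\<^sup>2\<close>, so \<open>(x + y + 2 * \<beta>) * y = (y + \<beta>)\<^sup>2\<close> is a square, and
  the positive Wronskian (\<open>jacobi_poly_wronskian_pos\<close>) says that \<open>y\<close> has the sign of \<open>\<chi>\<^sub>m'(s)\<close>. The
  square can vanish only if \<open>y\<close> and \<open>\<beta>\<close> have opposite signs; since the sign of \<open>\<chi>\<^sub>m'(\<mu> k)\<close> is
  \<open>(-1) ^ (m - k)\<close>, this is the distinction between the strict and the weak case, and it is already
  the statement on the signs of \<open>\<chi>\<^sub>n(\<mu> k)\<close>.

  The rest holds for any polynomial of this form with nonnegative weights. Taking imaginary parts
  locates the roots in a half-plane or on the real line (\<open>Im_arrow_poly_root\<close>). For real \<open>a\<close> and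
  positive weights, the roots are simple and any two of them have a node in between, because
  the rational function in parentheses is increasing between its poles. Nodes of weight 0 split
  off as linear factors. Both together bound multiplicities (\<open>arrow_poly_order\<close>) and bound the number
  of roots in an interval by one more than the number of nodes there
  (\<open>arrow_poly_root_count\<close>), which is interlacing.
\<close>

section \<open>Polynomials with nonnegative weights at real nodes\<close>

definition node_poly :: "real set \<Rightarrow> complex poly" where
  "node_poly S = (\<Prod>s\<in>S. [:- complex_of_real s, 1:])"

text \<open>
  This is the characteristic polynomial of the arrowhead matrix with the elements of \<open>S\<close> on its
  diagonal, \<open>a\<close> in the corner and the square roots of the weights \<open>r s\<close> in the border. Dividing by
  \<^term>\<open>node_poly S\<close> gives \<open>\<lambda> - a - (\<Sum>s\<in>S. r s / (\<lambda> - s))\<close>, which for real \<open>a\<close> and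
  nonnegative weights is increasing between its poles and maps the open upper and the open lower
  half-plane into itself.
\<close>

definition arrow_poly :: "complex \<Rightarrow> (real \<Rightarrow> real) \<Rightarrow> real set \<Rightarrow> complex poly" where
  "arrow_poly a r S =
     [:- a, 1:] * node_poly S - (\<Sum>s\<in>S. Polynomial.smult (complex_of_real (r s)) (node_poly (S - {s})))"

lemma poly_node_poly: "poly (node_poly S) z = (\<Prod>s\<in>S. z - complex_of_real s)"
  by (simp add: node_poly_def poly_prod)

lemma node_poly_nonzero [simp]: "node_poly S \<noteq> 0"
  by (cases "finite S") (auto simp: node_poly_def)

lemma node_poly_remove:
  assumes "finite S" "s \<in> S"
  shows "node_poly S = [:- complex_of_real s, 1:] * node_poly (S - {s})"
  using assms by (simp add: node_poly_def prod.remove)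

lemma degree_node_poly [simp]: "degree (node_poly S) = card S"
  unfolding node_poly_def by (subst degree_prod_eq_sum_degree) auto

lemma proots_node_poly:
  assumes "finite S"
  shows "proots (node_poly S) = image_mset complex_of_real (mset_set S)"
proof -
  have "proots (node_poly S) = (\<Sum>s\<in>S. {#complex_of_real s#})"
    unfolding node_poly_def by (subst proots_prod) auto
  also have "\<dots> = image_mset complex_of_real (mset_set S)"
    using assms by (induction S) auto
  finally show ?thesis .
qed

lemma poly_arrow_poly_at_node:
  assumes "finite S" "s \<in> S"
  shows "poly (arrow_poly a r S) (complex_of_real s) = complex_of_real (- r s * (\<Prod>t\<in>S - {s}. s - t))"
proof -
  have zero: "poly (node_poly (S - T)) (complex_of_real s) = 0" if "s \<notin> T" for T
    using assms that by (auto simp: poly_node_poly)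
  have "(\<Sum>u\<in>S. complex_of_real (r u) * poly (node_poly (S - {u})) (complex_of_real s))
      = complex_of_real (r s) * poly (node_poly (S - {s})) (complex_of_real s)"
    using assms by (subst sum.remove[of _ s]) (auto intro!: sum.neutral zero)
  then show ?thesis
    using zero[of "{}"] by (simp add: arrow_poly_def poly_sum poly_node_poly)
qed

text \<open>
  Lagrange interpolation: once the leading part \<open>(X - a) * node_poly S\<close> is split off, the rest has
  degree less than the number of nodes, so it is determined by the values at the nodes, and the
  weights are these values up to the factors \<open>s - t\<close>.
\<close>

lemma eq_arrow_polyI:
  assumes S: "finite S" and deg: "degree (p - [:- a, 1:] * node_poly S) < card S"
    and val: "\<And>s. s \<in> S \<Longrightarrow>
      poly p (complex_of_real s) = complex_of_real (- r s * (\<Prod>t\<in>S - {s}. s - t))"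
  shows "p = arrow_poly a r S"
proof -
  let ?g = "arrow_poly a r S - [:- a, 1:] * node_poly S"
  have "p - [:- a, 1:] * node_poly S = ?g"
  proof (rule poly_eqI_degree[where A = "complex_of_real ` S"])
    fix z assume "z \<in> complex_of_real ` S"
    then obtain s where s: "s \<in> S" "z = complex_of_real s" by auto
    show "poly (p - [:- a, 1:] * node_poly S) z = poly ?g z"
      unfolding s(2) poly_diff val[OF s(1)] poly_arrow_poly_at_node[OF S s(1)] ..
  next
    have "degree (\<Sum>s\<in>S. Polynomial.smult (complex_of_real (r s)) (node_poly (S - {s}))) < card S"
      using S deg
      by (intro degree_sum_less le_less_trans[OF degree_smult_le]) (auto simp: card_gt_0_iff)
    then show "degree ?g < card (complex_of_real ` S)"
      by (simp add: arrow_poly_def card_image inj_on_def)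
  qed (use deg in \<open>simp add: card_image inj_on_def\<close>)
  then show ?thesis by simp
qed

lemma poly_arrow_poly_off_nodes:
  assumes "finite S" "z \<notin> complex_of_real ` S"
  shows "poly (arrow_poly a r S) z
       = poly (node_poly S) z * (z - a - (\<Sum>s\<in>S. complex_of_real (r s) / (z - complex_of_real s)))"
proof -
  have "complex_of_real (r s) * poly (node_poly (S - {s})) z
      = poly (node_poly S) z * (complex_of_real (r s) / (z - complex_of_real s))" if "s \<in> S" for s
  proof -
    have "z - complex_of_real s \<noteq> 0" using assms that by auto
    then show ?thesis
      using assms that by (simp add: node_poly_remove[of S s] field_simps)
  qed
  then show ?thesis
    by (simp add: arrow_poly_def poly_sum sum_distrib_left algebra_simps)
qed

lemma arrow_poly_root_off_nodes:
  assumes "finite S" "z \<notin> complex_of_real ` S" "poly (arrow_poly a r S) z = 0"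
  shows "z - a = (\<Sum>s\<in>S. complex_of_real (r s) / (z - complex_of_real s))"
proof -
  have "poly (node_poly S) z \<noteq> 0"
    using assms by (auto simp: poly_node_poly)
  then show ?thesis
    using assms by (simp add: poly_arrow_poly_off_nodes)
qed

text \<open>
  Take imaginary parts in the equation \<open>z - a = (\<Sum>s\<in>S. r s / (z - s))\<close>. The factor next to \<open>Im z\<close> is
  positive for nonnegative weights, so off the nodes \<open>Im z\<close> and \<open>Im a\<close> have the same sign. This one
  identity locates the spectrum both for real and for nonreal \<open>a\<close>.
\<close>

lemma Im_arrow_poly_root:
  assumes "finite S" "z \<notin> complex_of_real ` S" "poly (arrow_poly a r S) z = 0"
  shows "Im z * (1 + (\<Sum>s\<in>S. r s / (cmod (z - complex_of_real s))\<^sup>2)) = Im a"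
proof -
  have "Im (complex_of_real (r s) / (z - complex_of_real s))
      = - (Im z * (r s / (cmod (z - complex_of_real s))\<^sup>2))" for s
    by (simp add: Im_divide cmod_power2)
  then have "Im z - Im a = - (Im z * (\<Sum>s\<in>S. r s / (cmod (z - complex_of_real s))\<^sup>2))"
    using arg_cong[OF arrow_poly_root_off_nodes[OF assms], of Im]
    by (simp add: sum_negf sum_distrib_left)
  then show ?thesis
    by (simp add: algebra_simps)
qed

text \<open>
  If \<open>x\<close> and \<open>y\<close> lie off the nodes, the function \<open>F \<lambda> = \<lambda> - a - (\<Sum>s\<in>S. r s / (\<lambda> - s))\<close> satisfies
  \<open>F y - F x = (y - x) * (1 + (\<Sum>s\<in>S. r s / ((x - s) * (y - s))))\<close>. The polynomial below is the
  second factor on the right, as a function of \<open>y\<close>, with denominators cleared. It plays the part of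
  the derivative of \<open>F\<close> (at \<open>y = x\<close>) and of the monotonicity of \<open>F\<close> (at \<open>y \<noteq> x\<close>) without any
  calculus.
\<close>

definition arrow_quotient :: "(real \<Rightarrow> real) \<Rightarrow> real set \<Rightarrow> complex \<Rightarrow> complex poly" where
  "arrow_quotient r S x = node_poly S +
     (\<Sum>s\<in>S. Polynomial.smult (complex_of_real (r s) / (x - complex_of_real s)) (node_poly (S - {s})))"

lemma arrow_poly_divide_root:
  assumes S: "finite S" "x \<notin> complex_of_real ` S" and root: "poly (arrow_poly a r S) x = 0"
  shows "arrow_poly a r S = [:- x, 1:] * arrow_quotient r S x"
proof -
  let ?w = "\<lambda>s. complex_of_real (r s) / (x - complex_of_real s)"
  have summand: "[:- x, 1:] * Polynomial.smult (?w s) (node_poly (S - {s}))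
      = Polynomial.smult (?w s) (node_poly S) - Polynomial.smult (complex_of_real (r s)) (node_poly (S - {s}))"
    if "s \<in> S" for s
  proof -
    have "x - complex_of_real s \<noteq> 0" using S that by auto
    then have "?w s * (x - complex_of_real s) = complex_of_real (r s)" by simp
    moreover have "[:- x, 1:] = [:- complex_of_real s, 1:] - [:x - complex_of_real s:]" by simp
    ultimately show ?thesis
      using S that
      by (simp only: node_poly_remove[of S s] left_diff_distrib)
         (simp add: smult_diff_right algebra_simps)
  qed
  have "[:- x, 1:] * (\<Sum>s\<in>S. Polynomial.smult (?w s) (node_poly (S - {s})))
      = (\<Sum>s\<in>S. Polynomial.smult (?w s) (node_poly S))
        - (\<Sum>s\<in>S. Polynomial.smult (complex_of_real (r s)) (node_poly (S - {s})))"
    unfolding sum_distrib_left sum_subtractf[symmetric] by (intro sum.cong refl summand)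
  also have "(\<Sum>s\<in>S. Polynomial.smult (?w s) (node_poly S)) = [:x - a:] * node_poly S"
    by (simp add: arrow_poly_root_off_nodes[OF S root] smult_sum)
  finally have "[:- x, 1:] * (node_poly S + (\<Sum>s\<in>S. Polynomial.smult (?w s) (node_poly (S - {s}))))
      = ([:- x, 1:] + [:x - a:]) * node_poly S
        - (\<Sum>s\<in>S. Polynomial.smult (complex_of_real (r s)) (node_poly (S - {s})))"
    by (simp only: distrib_left distrib_right) simp
  then show ?thesis
    by (simp add: arrow_poly_def arrow_quotient_def)
qed

lemma poly_arrow_quotient:
  assumes "finite S" "x \<notin> S" "y \<notin> S"
  shows "poly (arrow_quotient r S (complex_of_real x)) (complex_of_real y)
       = complex_of_real ((\<Prod>s\<in>S. y - s) * (1 + (\<Sum>s\<in>S. r s / ((x - s) * (y - s)))))"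
proof -
  have "complex_of_real (r s) / (complex_of_real x - complex_of_real s) * (\<Prod>t\<in>S - {s}. complex_of_real y - complex_of_real t)
      = complex_of_real ((\<Prod>s\<in>S. y - s) * (r s / ((x - s) * (y - s))))" if "s \<in> S" for s
  proof -
    have "complex_of_real y - complex_of_real s \<noteq> 0" using assms that by auto
    then show ?thesis
      using assms that by (simp add: prod.remove[of S s])
  qed
  then show ?thesis
    by (simp add: arrow_quotient_def poly_sum poly_node_poly sum_distrib_left distrib_left)
qed

text \<open>
  A node of weight 0 is a common root of the arrow polynomial and the node polynomial. Splitting
  such nodes off reduces nonnegative weights to positive ones, for which the roots turn out to be
  simple when \<open>a\<close> is real; a double root is then a root of the reduced polynomial that happens to be
  one of the nodes split off.
\<close>

lemma arrow_poly_drop_zero_weights: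
  assumes "finite S"
  shows "arrow_poly a r S = arrow_poly a r {s\<in>S. r s \<noteq> 0} * node_poly {s\<in>S. r s = 0}"
proof -
  let ?P = "{s\<in>S. r s \<noteq> 0}" and ?Z = "{s\<in>S. r s = 0}"
  have split: "node_poly (S - T) = node_poly (?P - T) * node_poly ?Z" if "T \<subseteq> ?P" for T
    unfolding node_poly_def using assms that
    by (subst prod.union_disjoint[symmetric]) (auto intro!: prod.cong)
  have "(\<Sum>s\<in>S. Polynomial.smult (complex_of_real (r s)) (node_poly (S - {s})))
      = (\<Sum>s\<in>?P. Polynomial.smult (complex_of_real (r s)) (node_poly (S - {s})))"
    using assms by (intro sum.mono_neutral_right) auto
  also have "\<dots> = (\<Sum>s\<in>?P. Polynomial.smult (complex_of_real (r s)) (node_poly (?P - {s}))) * node_poly ?Z"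
    by (simp add: split sum_distrib_right)
  finally show ?thesis
    using split[of "{}"] by (simp add: arrow_poly_def algebra_simps)
qed

lemma arrow_poly_nonzero:
  assumes "finite S"
  shows "arrow_poly a r S \<noteq> 0"
proof
  assume zero: "arrow_poly a r S = 0"
  let ?p = "[:- a, 1:] * node_poly S"
  have "?p = (\<Sum>s\<in>S. Polynomial.smult (complex_of_real (r s)) (node_poly (S - {s})))"
    using zero by (simp add: arrow_poly_def)
  also have "degree \<dots> \<le> card S"
    using assms by (intro degree_sum_le order.trans[OF degree_smult_le]) (auto simp: card_Diff1_le)
  also have "degree ?p = Suc (card S)"
    by (subst degree_mult_eq) auto
  finally show False by simp
qed

lemma arrow_poly_pos_weights_roots:
  assumes S: "finite S" and a: "a \<in> \<real>" and pos: "\<And>s. s \<in> S \<Longrightarrow> r s > 0"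
    and root: "poly (arrow_poly a r S) z = 0"
  obtains x where "z = complex_of_real x" "x \<notin> S"
proof -
  have off: "z \<notin> complex_of_real ` S"
  proof
    assume "z \<in> complex_of_real ` S"
    then obtain s where "s \<in> S" "z = complex_of_real s" by auto
    then have "complex_of_real (- r s * (\<Prod>t\<in>S - {s}. s - t)) = 0"
      using root by (simp only: poly_arrow_poly_at_node[OF S])
    then have "r s * (\<Prod>t\<in>S - {s}. s - t) = 0"
      unfolding of_real_eq_0_iff by simp
    then show False using S pos[OF \<open>s \<in> S\<close>] by auto
  qed
  have "1 + (\<Sum>s\<in>S. r s / (cmod (z - complex_of_real s))\<^sup>2) > 0"
    using pos by (intro add_pos_nonneg sum_nonneg) (auto simp: less_imp_le)
  moreover have "Im a = 0"
    using a by (simp add: complex_is_Real_iff)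
  ultimately have "Im z = 0"
    using Im_arrow_poly_root[OF S off root] by auto
  then have "z = complex_of_real (Re z)"
    by (simp add: complex_eq_iff)
  with off that show thesis by blast
qed

text \<open>
  The cofactor of \<open>X - x\<close> takes at \<open>x\<close> itself the value \<open>1 + (\<Sum>s\<in>S. r s / (x - s)\<^sup>2)\<close> times a
  nonzero number.
\<close>

lemma arrow_poly_pos_weights_order:
  assumes S: "finite S" and a: "a \<in> \<real>" and pos: "\<And>s. s \<in> S \<Longrightarrow> r s > 0"
    and root: "poly (arrow_poly a r S) z = 0"
  shows "Polynomial.order z (arrow_poly a r S) = 1"
proof -
  obtain x where x: "z = complex_of_real x" "x \<notin> S"
    using arrow_poly_pos_weights_roots[OF assms] .
  define q where "q = arrow_quotient r S z"
  have fac: "arrow_poly a r S = [:- z, 1:] * q"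
    unfolding q_def using x by (intro arrow_poly_divide_root S root) auto
  have "1 + (\<Sum>s\<in>S. r s / ((x - s) * (x - s))) > 0"
    using pos by (intro add_pos_nonneg sum_nonneg) (auto simp: less_imp_le)
  moreover have "(\<Prod>s\<in>S. x - s) \<noteq> 0" using S x by auto
  ultimately have "poly q z \<noteq> 0"
    unfolding q_def x(1) poly_arrow_quotient[OF S x(2) x(2)] of_real_eq_0_iff by auto
  then show ?thesis
    unfolding fac using arrow_poly_nonzero[OF S, of a r]
    by (subst order_mult) (auto simp: fac order_0I order_linear)
qed

text \<open>
  If no node lies between two roots \<open>x\<close> and \<open>y\<close>, every product \<open>(x - s) * (y - s)\<close> is positive, so
  the cofactor of \<open>X - x\<close> cannot vanish at \<open>y\<close>.
\<close>

lemma arrow_poly_pos_weights_node_between: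
  assumes S: "finite S" and a: "a \<in> \<real>" and pos: "\<And>s. s \<in> S \<Longrightarrow> r s > 0"
    and x: "poly (arrow_poly a r S) (complex_of_real x) = 0"
    and y: "poly (arrow_poly a r S) (complex_of_real y) = 0"
    and less: "x < y"
  obtains s where "s \<in> S" "x < s" "s < y"
proof -
  have off: "u \<notin> S" if "poly (arrow_poly a r S) (complex_of_real u) = 0" for u
    using arrow_poly_pos_weights_roots[OF S a pos that] by (metis of_real_eq_iff)
  have "\<exists>s\<in>S. x < s \<and> s < y"
  proof (rule ccontr)
    assume none: "\<not> ?thesis"
    have "(x - s) * (y - s) > 0" if "s \<in> S" for s
    proof -
      have "s < x \<or> y < s" using none off[OF x] off[OF y] that by (metis linorder_neqE_linordered_idom)
      then show ?thesis using less by (auto intro: mult_pos_pos mult_neg_neg)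
    qed
    then have "1 + (\<Sum>s\<in>S. r s / ((x - s) * (y - s))) > 0"
      using pos by (intro add_pos_nonneg sum_nonneg) (auto simp: less_imp_le)
    moreover have "(\<Prod>s\<in>S. y - s) \<noteq> 0" using S off[OF y] by auto
    moreover define q where "q = arrow_quotient r S (complex_of_real x)"
    ultimately have "poly q (complex_of_real y) \<noteq> 0"
      unfolding q_def poly_arrow_quotient[OF S off[OF x] off[OF y]] of_real_eq_0_iff by auto
    moreover have "arrow_poly a r S = [:- complex_of_real x, 1:] * q"
      unfolding q_def using off[OF x] by (intro arrow_poly_divide_root S x) auto
    ultimately show False
      using y less by simp
  qed
  with that show thesis by blast
qed

lemma card_le_Suc_card_of_separated:
  fixes A B :: "'a::linorder set"
  assumes "finite A" "finite B" "\<And>x y. x \<in> A \<Longrightarrow> y \<in> A \<Longrightarrow> x < y \<Longrightarrow> \<exists>s\<in>B. x < s \<and> s < y"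
  shows "card A \<le> Suc (card B)"
  using assms
proof (induction A arbitrary: B rule: finite_linorder_max_induct)
  case empty
  then show ?case by simp
next
  case (insert y A)
  show ?case
  proof (cases "A = {}")
    case False
    let ?m = "Max A" and ?B = "{s\<in>B. s < Max A}"
    have m: "?m \<in> A" using False insert by simp
    then obtain s where s: "s \<in> B" "?m < s"
      using insert.prems(2)[of ?m y] insert.hyps by auto
    have "card A \<le> Suc (card ?B)"
    proof (rule insert.IH)
      fix u v assume uv: "u \<in> A" "v \<in> A" "u < v"
      then obtain s where "s \<in> B" "u < s" "s < v" using insert.prems(2)[of u v] by auto
      moreover have "v \<le> ?m" using uv insert.hyps by simp
      ultimately show "\<exists>s\<in>?B. u < s \<and> s < v" by auto
    qed (use insert in auto)
    also have "Suc (card ?B) = card (insert s ?B)"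
      using s insert by simp
    also have "\<dots> \<le> card B"
      using s insert by (intro card_mono) auto
    finally show ?thesis using insert by (simp add: card_insert_if)
  qed simp
qed

text \<open>
  This is interlacing in a form insensitive to common roots: a zero-weight node adds one root and
  one node to exactly the same intervals, and the remaining roots are simple and separated by
  nodes.
\<close>

lemma arrow_poly_root_count:
  assumes S: "finite S" and a: "a \<in> \<real>" and nonneg: "\<And>s. s \<in> S \<Longrightarrow> r s \<ge> 0"
    and I: "\<And>x y. x \<in> I \<Longrightarrow> y \<in> I \<Longrightarrow> {x<..<y} \<subseteq> I"
  shows "size {#z \<in># proots (arrow_poly a r S). Re z \<in> I#} \<le> Suc (card (S \<inter> I))"
proof -
  define P where "P = {s\<in>S. r s \<noteq> 0}"
  define Z where "Z = {s\<in>S. r s = 0}"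
  define p where "p = arrow_poly a r P"
  define X where "X = {x. poly p (complex_of_real x) = 0}"
  have fin: "finite P" "finite Z" using S by (auto simp: P_def Z_def)
  have pos: "r s > 0" if "s \<in> P" for s using that nonneg[of s] by (auto simp: P_def)
  have p: "p \<noteq> 0" unfolding p_def by (rule arrow_poly_nonzero[OF fin(1)])
  have X: "finite X"
  proof -
    have "finite (complex_of_real -` {z. poly p z = 0})"
      using p by (intro finite_vimageI poly_roots_finite) (auto simp: inj_on_def)
    then show ?thesis by (simp add: X_def vimage_def)
  qed
  \<comment> \<open>With positive weights all roots are real and simple, so the root multiset is a set.\<close>
  have roots_p: "proots p = image_mset complex_of_real (mset_set X)"
  proof (rule multiset_eqI)
    fix z
    have "count (image_mset complex_of_real (mset_set X)) z = count (mset_set (complex_of_real ` X)) z"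
      by (subst image_mset_mset_set) (auto simp: inj_on_def)
    also have "\<dots> = (if z \<in> complex_of_real ` X then 1 else 0)"
      using X by simp
    also have "\<dots> = Polynomial.order z p"
    proof (cases "poly p z = 0")
      case True
      then obtain x where "z = complex_of_real x"
        using arrow_poly_pos_weights_roots[OF fin(1) a, of r z] pos unfolding p_def by blast
      then have "z \<in> complex_of_real ` X" using True by (auto simp: X_def)
      moreover have "Polynomial.order z p = 1"
        using True unfolding p_def by (intro arrow_poly_pos_weights_order fin a pos)
      ultimately show ?thesis by simp
    qed (auto simp: X_def order_0I)
    finally show "count (proots p) z = count (image_mset complex_of_real (mset_set X)) z"
      using p by simp
  qed
  have "proots (arrow_poly a r S) = image_mset complex_of_real (mset_set X + mset_set Z)"
    using arrow_poly_drop_zero_weights[OF S, of a r, folded P_def Z_def p_def] p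
    by (simp add: proots_mult roots_p proots_node_poly fin)
  then have "size {#z \<in># proots (arrow_poly a r S). Re z \<in> I#} = card (X \<inter> I) + card (Z \<inter> I)"
    using X fin by (simp add: filter_mset_image_mset filter_mset_mset_set Int_def)
  also have "card (X \<inter> I) \<le> Suc (card (P \<inter> I))"
  proof (rule card_le_Suc_card_of_separated)
    fix x y assume xy: "x \<in> X \<inter> I" "y \<in> X \<inter> I" "x < y"
    then obtain s where "s \<in> P" "x < s" "s < y"
      using arrow_poly_pos_weights_node_between[OF fin(1) a, of r x y] pos unfolding X_def p_def by blast
    with I[of x y] xy show "\<exists>s\<in>P \<inter> I. x < s \<and> s < y" by auto
  qed (use X fin in auto)
  also have "Suc (card (P \<inter> I)) + card (Z \<inter> I) = Suc (card ((P \<inter> I) \<union> (Z \<inter> I)))"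
    using fin by (subst card_Un_disjoint) (auto simp: P_def Z_def)
  also have "(P \<inter> I) \<union> (Z \<inter> I) = S \<inter> I" by (auto simp: P_def Z_def)
  finally show ?thesis by simp
qed

lemma arrow_poly_order:
  assumes S: "finite S" and a: "a \<in> \<real>" and nonneg: "\<And>s. s \<in> S \<Longrightarrow> r s \<ge> 0"
  shows "Polynomial.order z (arrow_poly a r S) \<le> 1 + (if z \<in> complex_of_real ` S then 1 else 0)"
proof -
  define P where "P = {s\<in>S. r s \<noteq> 0}"
  define Z where "Z = {s\<in>S. r s = 0}"
  have fin: "finite P" "finite Z" using S by (auto simp: P_def Z_def)
  have pos: "r s > 0" if "s \<in> P" for s using that nonneg[of s] by (auto simp: P_def)
  have "Polynomial.order z (arrow_poly a r P) \<le> 1"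
    using arrow_poly_pos_weights_order[OF fin(1) a, of r z] pos
    by (cases "poly (arrow_poly a r P) z = 0") (auto simp: order_0I)
  moreover have "Polynomial.order z (node_poly Z) = count (mset_set (complex_of_real ` Z)) z"
    using proots_node_poly[OF fin(2)]
    by (subst count_proots[symmetric]) (auto simp: image_mset_mset_set inj_on_def)
  then have "Polynomial.order z (node_poly Z) \<le> (if z \<in> complex_of_real ` S then 1 else 0)"
    using fin by (auto simp: Z_def count_mset_set')
  ultimately show ?thesis
    using arrow_poly_drop_zero_weights[OF S, of a r, folded P_def Z_def] arrow_poly_nonzero[OF fin(1), of a r]
    by (auto simp: order_mult)
qed

section \<open>Determinants of bordered and tridiagonal matrices\<close>

definition bordered_mat :: "nat \<Rightarrow> 'a mat \<Rightarrow> (nat \<Rightarrow> 'a) \<Rightarrow> (nat \<Rightarrow> 'a) \<Rightarrow> 'a \<Rightarrow> 'a mat" where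
  "bordered_mat m A v w d = mat (Suc m) (Suc m) (\<lambda>(i, j).
     if i < m then if j < m then A $$ (i, j) else v i else if j < m then w j else d)"

text \<open>
  Laplace expansion along the last row and then along the last column. It serves twice: a
  tridiagonal matrix arises from its leading part by a border with one nonzero entry per side, and
  the periodic matrix by a border with two.
\<close>

lemma det_bordered_mat:
  fixes A :: "'a::comm_ring_1 mat"
  assumes A: "A \<in> carrier_mat m m"
  shows "det (bordered_mat m A v w d) = d * det A - (\<Sum>j<m. \<Sum>i<m. w j * v i * cofactor A i j)"
proof -
  let ?M = "bordered_mat m A v w d"
  have M: "?M \<in> carrier_mat (Suc m) (Suc m)" by (simp add: bordered_mat_def)
  have last: "mat_delete ?M m m = A"
    using A by (auto simp: mat_delete_def bordered_mat_def)
  have minor: "cofactor ?M m j = - (\<Sum>i<m. v i * cofactor A i j)" if j: "j < m" for j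
  proof -
    obtain k where k: "m = Suc k" using j by (cases m) auto
    let ?D = "mat_delete ?M m j"
    have D: "?D \<in> carrier_mat m m" using mat_delete_carrier[OF M] by simp
    have "det ?D = (\<Sum>i<m. ?D $$ (i, k) * cofactor ?D i k)"
      by (rule laplace_expansion_column[OF D]) (simp add: k)
    also have "\<dots> = (\<Sum>i<m. v i * ((-1) ^ (i + k) * det (mat_delete A i j)))"
    proof (intro sum.cong refl arg_cong2[of _ _ _ _ "(*)"])
      fix i assume i: "i \<in> {..<m}"
      show "?D $$ (i, k) = v i"
        using i j k by (auto simp: mat_delete_def bordered_mat_def)
      have "mat_delete ?D i k = mat_delete A i j"
        using A i j k by (auto simp: mat_delete_def bordered_mat_def)
      then show "cofactor ?D i k = (-1) ^ (i + k) * det (mat_delete A i j)"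
        by (simp add: cofactor_def)
    qed
    finally have "cofactor ?M m j = (\<Sum>i<m. (-1) ^ (m + j) * (v i * ((-1) ^ (i + k) * det (mat_delete A i j))))"
      by (simp add: cofactor_def sum_distrib_left)
    also have "\<dots> = (\<Sum>i<m. - (v i * cofactor A i j))"
    proof (intro sum.cong refl)
      fix i
      have "(-1::'a) ^ (m + j) * (-1) ^ (i + k) = - ((-1) ^ (i + j))"
      proof -
        have "(-1::'a) ^ (m + j) * (-1) ^ (i + k) = - (((-1) ^ k * (-1) ^ k) * (-1) ^ (i + j))"
          unfolding k by (simp add: power_add mult.assoc mult.commute mult.left_commute)
        also have "(-1::'a) ^ k * (-1) ^ k = 1"
          by (simp flip: power_mult_distrib)
        finally show ?thesis by simp
      qed
      then show "(-1) ^ (m + j) * (v i * ((-1) ^ (i + k) * det (mat_delete A i j))) = - (v i * cofactor A i j)"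
        by (simp add: cofactor_def) (metis (no_types, lifting) mult.assoc mult.left_commute mult_minus_left)
    qed
    finally show ?thesis by (simp add: sum_negf)
  qed
  have "det ?M = (\<Sum>j<Suc m. ?M $$ (m, j) * cofactor ?M m j)"
    by (rule laplace_expansion_row[OF M]) simp
  also have "\<dots> = (\<Sum>j<m. w j * cofactor ?M m j) + d * det A"
    by (simp add: cofactor_def last) (simp add: bordered_mat_def)
  finally show ?thesis
    by (simp add: minor sum_distrib_left sum_negf mult.assoc)
qed

definition tridiag_mat :: "nat \<Rightarrow> (nat \<Rightarrow> 'a) \<Rightarrow> (nat \<Rightarrow> 'a) \<Rightarrow> (nat \<Rightarrow> 'a) \<Rightarrow> 'a::zero mat" where
  "tridiag_mat m d u l = mat m m (\<lambda>(i, j).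
     if i = j then d i else if j = Suc i then u i else if i = Suc j then l j else 0)"

lemma tridiag_mat_carrier [simp]: "tridiag_mat m d u l \<in> carrier_mat m m"
  by (simp add: tridiag_mat_def)

lemma det_tridiag_mat_0 [simp]: "det (tridiag_mat 0 d u l) = 1"
  by (rule det_dim_zero) simp

lemma det_tridiag_mat_1 [simp]: "det (tridiag_mat (Suc 0) d u l) = d 0"
  by (subst det_single) (auto simp: tridiag_mat_def)

lemma mat_delete_tridiag_mat_first:
  "mat_delete (tridiag_mat (Suc m) d u l) 0 0 = tridiag_mat m (d \<circ> Suc) (u \<circ> Suc) (l \<circ> Suc)"
  by (auto simp: mat_delete_def tridiag_mat_def)

lemma mat_delete_tridiag_mat_last:
  "mat_delete (tridiag_mat (Suc m) d u l) m m = tridiag_mat m d u l"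
  by (auto simp: mat_delete_def tridiag_mat_def)

text \<open>
  Deleting the first row and the last column moves the lower diagonal onto the main diagonal and
  leaves a triangular matrix; the next lemma is the mirror image.
\<close>

lemma det_mat_delete_tridiag_mat_upper:
  fixes d :: "nat \<Rightarrow> 'a::comm_ring_1"
  shows "det (mat_delete (tridiag_mat (Suc m) d u l) 0 m) = (\<Prod>i<m. l i)"
proof -
  let ?D = "mat_delete (tridiag_mat (Suc m) d u l) 0 m"
  have D: "?D \<in> carrier_mat m m" by (simp add: mat_delete_def tridiag_mat_def)
  have "upper_triangular ?D"
    by (auto simp: mat_delete_def tridiag_mat_def)
  then have "det ?D = prod_list (diag_mat ?D)"
    using D by (rule det_upper_triangular)
  also have "\<dots> = (\<Prod>i<m. l i)"
    by (simp add: prod_list_diag_prod atLeast0LessThan) (auto simp: mat_delete_def tridiag_mat_def intro!: prod.cong)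
  finally show ?thesis .
qed

lemma det_mat_delete_tridiag_mat_lower:
  fixes d :: "nat \<Rightarrow> 'a::comm_ring_1"
  shows "det (mat_delete (tridiag_mat (Suc m) d u l) m 0) = (\<Prod>i<m. u i)"
proof -
  let ?D = "mat_delete (tridiag_mat (Suc m) d u l) m 0"
  have D: "?D \<in> carrier_mat m m" by (simp add: mat_delete_def tridiag_mat_def)
  have "det ?D = prod_list (diag_mat ?D)"
    using _ D by (rule det_lower_triangular) (auto simp: mat_delete_def tridiag_mat_def)
  also have "\<dots> = (\<Prod>i<m. u i)"
    by (simp add: prod_list_diag_prod atLeast0LessThan) (auto simp: mat_delete_def tridiag_mat_def intro!: prod.cong)
  finally show ?thesis .
qed

lemma det_tridiag_mat_rec:
  fixes d :: "nat \<Rightarrow> 'a::comm_ring_1"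
  shows "det (tridiag_mat (Suc (Suc m)) d u l)
       = d (Suc m) * det (tridiag_mat (Suc m) d u l) - u m * l m * det (tridiag_mat m d u l)"
proof -
  let ?A = "tridiag_mat (Suc m) d u l"
  let ?v = "\<lambda>i. if i = m then u m else 0" and ?w = "\<lambda>j. if j = m then l m else 0"
  have "tridiag_mat (Suc (Suc m)) d u l = bordered_mat (Suc m) ?A ?v ?w (d (Suc m))" (is "?L = ?R")
  proof (rule eq_matI)
    fix i j assume "i < dim_row ?R" "j < dim_col ?R"
    then show "?L $$ (i, j) = ?R $$ (i, j)"
      by (cases "i = Suc m"; cases "j = Suc m") (simp_all add: tridiag_mat_def bordered_mat_def)
  qed (simp_all add: tridiag_mat_def bordered_mat_def)
  moreover have "cofactor ?A m m = det (tridiag_mat m d u l)"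
    by (simp add: cofactor_def mat_delete_tridiag_mat_last)
  moreover have "(\<Sum>j<Suc m. \<Sum>i<Suc m. ?w j * ?v i * cofactor ?A i j) = l m * u m * cofactor ?A m m"
    by (subst sum.lessThan_Suc, subst (2) sum.lessThan_Suc) simp
  ultimately show ?thesis
    by (simp only: det_bordered_mat[OF tridiag_mat_carrier] mult.commute)
qed

text \<open>
  Of the four cofactors selected by the border, the two diagonal ones are determinants of shorter
  tridiagonal matrices and the two corner ones are the products of the off-diagonals. The latter
  are the two ways of running once around the cycle of indices, which is how the product of
  all off-diagonal entries enters.
\<close>

lemma det_periodic_tridiag_mat:
  fixes d u l :: "nat \<Rightarrow> 'a::comm_ring_1" and k :: nat
  defines "A \<equiv> tridiag_mat (Suc (Suc k)) d u l"
  assumes v: "\<And>i. v i = (if i = 0 then v0 else if i = Suc k then v1 else 0)"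
    and w: "\<And>i. w i = (if i = 0 then w0 else if i = Suc k then w1 else 0)"
  shows "det (bordered_mat (Suc (Suc k)) A v w e)
       = e * det A
         - w0 * v0 * det (tridiag_mat (Suc k) (d \<circ> Suc) (u \<circ> Suc) (l \<circ> Suc))
         - w1 * v1 * det (tridiag_mat (Suc k) d u l)
         + (-1) ^ k * (w0 * v1 * (\<Prod>i<Suc k. u i) + w1 * v0 * (\<Prod>i<Suc k. l i))"
proof -
  let ?m = "Suc (Suc k)"
  have ends: "(\<Sum>i<?m. f i) = f 0 + f (Suc k)" if "\<And>i. i \<noteq> 0 \<Longrightarrow> i \<noteq> Suc k \<Longrightarrow> f i = 0" for f :: "nat \<Rightarrow> 'a"
  proof -
    have "(\<Sum>i<?m. f i) = sum f {0, Suc k}"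
      using that by (intro sum.mono_neutral_right) auto
    then show ?thesis by simp
  qed
  have "(\<Sum>j<?m. \<Sum>i<?m. w j * v i * cofactor A i j)
      = w0 * v0 * cofactor A 0 0 + w0 * v1 * cofactor A (Suc k) 0
        + w1 * v0 * cofactor A 0 (Suc k) + w1 * v1 * cofactor A (Suc k) (Suc k)"
    by (subst ends, simp add: w, subst (1 2) ends) (auto simp: v w)
  moreover have "cofactor A 0 0 = det (tridiag_mat (Suc k) (d \<circ> Suc) (u \<circ> Suc) (l \<circ> Suc))"
    by (simp add: cofactor_def A_def mat_delete_tridiag_mat_first)
  moreover have "cofactor A (Suc k) (Suc k) = det (tridiag_mat (Suc k) d u l)"
    by (simp add: cofactor_def A_def mat_delete_tridiag_mat_last)
  moreover have "cofactor A (Suc k) 0 = - ((-1) ^ k * (\<Prod>i<Suc k. u i))"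
    unfolding cofactor_def A_def det_mat_delete_tridiag_mat_lower by simp
  moreover have "cofactor A 0 (Suc k) = - ((-1) ^ k * (\<Prod>i<Suc k. l i))"
    unfolding cofactor_def A_def det_mat_delete_tridiag_mat_upper by simp
  ultimately show ?thesis
    by (subst det_bordered_mat) (simp_all add: A_def algebra_simps)
qed

section \<open>The three-term recurrence\<close>

text \<open>
  The characteristic polynomials of the leading submatrices of a Jacobi matrix depend on the
  off-diagonal entries only through their squared moduli \<open>w\<close>, hence they are real. Indices start
  at 0.
\<close>

fun jacobi_poly :: "(nat \<Rightarrow> real) \<Rightarrow> (nat \<Rightarrow> real) \<Rightarrow> nat \<Rightarrow> real poly" where
  "jacobi_poly c w 0 = 1"
| "jacobi_poly c w (Suc 0) = [:- c 0, 1:]"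
| "jacobi_poly c w (Suc (Suc k)) =
     [:- c (Suc k), 1:] * jacobi_poly c w (Suc k) - Polynomial.smult (w k) (jacobi_poly c w k)"

text \<open>
  \<open>jacobi_poly (c \<circ> Suc) (w \<circ> Suc)\<close> belongs to the matrix without its first row and column and
  satisfies the same recurrence with shifted index. So this Casoratian of two solutions changes
  only by a factor \<open>w\<close> in each step. At a root of \<open>jacobi_poly c w (Suc (Suc k))\<close> only the first
  product survives.
\<close>

lemma jacobi_poly_casoratian:
  "jacobi_poly (c \<circ> Suc) (w \<circ> Suc) (Suc k) * jacobi_poly c w (Suc k)
   - jacobi_poly c w (Suc (Suc k)) * jacobi_poly (c \<circ> Suc) (w \<circ> Suc) k
   = [:\<Prod>i<Suc k. w i:]"
proof (induction k)
  case 0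
  show ?case by simp
next
  case (Suc k)
  have rec: "jacobi_poly c w (Suc (Suc j)) =
     [:- c (Suc j), 1:] * jacobi_poly c w (Suc j) - [:w j:] * jacobi_poly c w j" for c w j
    by simp
  have "jacobi_poly (c \<circ> Suc) (w \<circ> Suc) (Suc (Suc k)) * jacobi_poly c w (Suc (Suc k))
   - jacobi_poly c w (Suc (Suc (Suc k))) * jacobi_poly (c \<circ> Suc) (w \<circ> Suc) (Suc k)
   = [:w (Suc k):] * (jacobi_poly (c \<circ> Suc) (w \<circ> Suc) (Suc k) * jacobi_poly c w (Suc k)
   - jacobi_poly c w (Suc (Suc k)) * jacobi_poly (c \<circ> Suc) (w \<circ> Suc) k)"
    unfolding rec[of "c \<circ> Suc" "w \<circ> Suc" k] rec[of c w "Suc k"] o_apply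
    by (simp only: algebra_simps)
  also have "\<dots> = [:\<Prod>i<Suc (Suc k). w i:]"
    unfolding Suc by (simp add: mult.commute)
  finally show ?case .
qed

text \<open>
  The recurrence turns the Wronskian into a sum of squares with positive coefficients. At a root of
  the longer polynomial it says that its derivative and the shorter polynomial have the same sign.
\<close>

lemma jacobi_poly_wronskian_pos:
  assumes "\<And>i. i < k \<Longrightarrow> w i > 0"
  shows "poly (pderiv (jacobi_poly c w (Suc k))) x * poly (jacobi_poly c w k) x
       - poly (jacobi_poly c w (Suc k)) x * poly (pderiv (jacobi_poly c w k)) x > 0"
  using assms
proof (induction k)
  case 0
  show ?case by (simp add: pderiv_pCons)
next
  case (Suc k)
  let ?P = "\<lambda>j. poly (jacobi_poly c w j) x" and ?D = "\<lambda>j. poly (pderiv (jacobi_poly c w j)) x"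
  have "?D (Suc (Suc k)) = ?P (Suc k) + (x - c (Suc k)) * ?D (Suc k) - w k * ?D k"
    by (simp add: pderiv_diff pderiv_add pderiv_mult pderiv_smult pderiv_pCons algebra_simps)
  moreover have "?P (Suc (Suc k)) = (x - c (Suc k)) * ?P (Suc k) - w k * ?P k"
    by (simp add: algebra_simps)
  ultimately have "?D (Suc (Suc k)) * ?P (Suc k) - ?P (Suc (Suc k)) * ?D (Suc k)
      = (?P (Suc k))\<^sup>2 + w k * (?D (Suc k) * ?P k - ?P (Suc k) * ?D k)"
    by (simp add: power2_eq_square left_diff_distrib right_diff_distrib distrib_left distrib_right mult_ac)
  moreover have "w k * (?D (Suc k) * ?P k - ?P (Suc k) * ?D k) > 0"
    using Suc by simp
  ultimately show ?case
    by (simp add: add_nonneg_pos)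
qed

lemma poly_det_tridiag_mat:
  assumes "\<And>i. u i * l i = [:complex_of_real (w i):]"
  shows "poly (det (tridiag_mat m (\<lambda>i. [:- complex_of_real (c i), 1:]) u l)) (complex_of_real x)
       = complex_of_real (poly (jacobi_poly c w m) x)"
  using assms by (induction c w m rule: jacobi_poly.induct) (simp_all add: det_tridiag_mat_rec assms)

section \<open>The characteristic polynomial of a periodic Jacobi matrix\<close>

definition jacobi_mat :: "nat \<Rightarrow> (nat \<Rightarrow> real) \<Rightarrow> (nat \<Rightarrow> complex) \<Rightarrow> complex mat" where
  "jacobi_mat m c b =
     tridiag_mat m (\<lambda>i. complex_of_real (c (Suc i))) (\<lambda>i. b (Suc i)) (\<lambda>i. cnj (b (Suc i)))"

lemma jacobi_mat_carrier [simp]: "jacobi_mat m c b \<in> carrier_mat m m"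
  by (simp add: jacobi_mat_def)

lemma J_mat_carrier [simp]: "J_mat n c b a \<in> carrier_mat n n"
  by (simp add: J_mat_def)

lemma leading_principal_submatrix_J_mat:
  "leading_principal_submatrix m (J_mat (Suc m) c b a) = jacobi_mat m c b"
proof -
  have pick: "pick {..<m} i = i" if "i < m" for i
  proof -
    have "{a \<in> {..<m}. a < i} = {..<i}" using that by auto
    then show ?thesis using pick_card_in_set[of i "{..<m}"] that by simp
  qed
  have card: "card {i. i < Suc m \<and> i < m} = m"
  proof -
    have "{i. i < Suc m \<and> i < m} = {..<m}" by auto
    then show ?thesis by simp
  qed
  show ?thesis
    unfolding leading_principal_submatrix_def submatrix_def
    by (intro eq_matI) (auto simp: card pick J_mat_def jacobi_mat_def tridiag_mat_def)
qed

lemma char_poly_jacobi_mat: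
  "char_poly (jacobi_mat m c b)
   = det (tridiag_mat m (\<lambda>i. [:- complex_of_real (c (Suc i)), 1:]) (\<lambda>i. [:- b (Suc i):])
            (\<lambda>i. [:- cnj (b (Suc i)):]))"
  unfolding char_poly_def char_poly_matrix_def jacobi_mat_def
  by (intro arg_cong[of _ _ det] eq_matI) (auto simp: tridiag_mat_def)

lemma const_poly_mult_cnj:
  "[:- z:] * [:- cnj z:] = [:complex_of_real ((cmod z)\<^sup>2):]"
  by (simp only: mult_pCons_left complex_norm_square) simp

lemma poly_char_poly_jacobi_mat:
  "poly (char_poly (jacobi_mat m c b)) (complex_of_real x)
   = complex_of_real (poly (jacobi_poly (c \<circ> Suc) (\<lambda>i. (cmod (b (Suc i)))\<^sup>2) m) x)"
  unfolding char_poly_jacobi_mat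
  using poly_det_tridiag_mat[OF const_poly_mult_cnj, of m "\<lambda>i. c (Suc i)"] by (simp add: comp_def)

text \<open>
  The two cycle products in the periodic determinant are conjugate to each other; for real \<open>\<beta>\<close> both
  equal \<open>- \<beta>\<close> up to the sign \<open>(-1) ^ k\<close>, so the dependence on the phases of the \<open>b i\<close> collapses to the
  constant \<open>2 * \<beta>\<close>.
\<close>

lemma char_poly_J_mat:
  fixes b :: "nat \<Rightarrow> complex" and k n :: nat
  defines "n \<equiv> Suc (Suc (Suc k))"
  assumes beta: "(\<Prod>i = 1..n. b i) = complex_of_real \<beta>"
  shows "char_poly (J_mat n c b a)
       = [:- a, 1:] * char_poly (jacobi_mat (Suc (Suc k)) c b)
         - [:complex_of_real ((cmod (b n))\<^sup>2):] * char_poly (jacobi_mat (Suc k) (c \<circ> Suc) (b \<circ> Suc))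
         - [:complex_of_real ((cmod (b (Suc (Suc k))))\<^sup>2):] * char_poly (jacobi_mat (Suc k) c b)
         - [:complex_of_real (2 * \<beta>):]"
proof -
  let ?m = "Suc (Suc k)"
  let ?d = "\<lambda>i. [:- complex_of_real (c (Suc i)), 1:]"
  let ?u = "\<lambda>i. [:- b (Suc i):]" and ?l = "\<lambda>i. [:- cnj (b (Suc i)):]"
  let ?v = "\<lambda>i. if i = 0 then [:- cnj (b n):] else if i = Suc k then [:- b ?m:] else 0"
  let ?w = "\<lambda>i. if i = 0 then [:- b n:] else if i = Suc k then [:- cnj (b ?m):] else 0"
  have bordered: "char_poly_matrix (J_mat n c b a) = bordered_mat ?m (tridiag_mat ?m ?d ?u ?l) ?v ?w [:- a, 1:]"
    (is "?L = ?R")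
  proof (rule eq_matI)
    fix i j assume "i < dim_row ?R" "j < dim_col ?R"
    then have ij: "i < Suc ?m" "j < Suc ?m" by (simp_all add: bordered_mat_def)
    have L: "?L $$ (i, j) = (if i = j then [:0, 1:] else 0) - [:J_mat n c b a $$ (i, j):]"
      using ij by (simp add: char_poly_matrix_def J_mat_def n_def)
    show "?L $$ (i, j) = ?R $$ (i, j)"
      unfolding L using ij
      by (cases "i = ?m"; cases "j = ?m")
         (simp_all add: J_mat_def n_def bordered_mat_def tridiag_mat_def)
  qed (simp_all add: char_poly_matrix_def J_mat_def n_def bordered_mat_def)

  have prod: "b n * (b ?m * (\<Prod>i<Suc k. b (Suc i))) = complex_of_real \<beta>"
  proof -
    have "(\<Prod>i<n. b (Suc i)) = (\<Prod>i = 1..n. b i)"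
      by (intro prod.reindex_bij_witness[of _ "\<lambda>i. i - 1" Suc]) auto
    then have "(\<Prod>i<n. b (Suc i)) = complex_of_real \<beta>"
      by (simp only: beta)
    then show ?thesis by (simp add: n_def mult_ac)
  qed
  have prod_cnj: "cnj (b n) * (cnj (b ?m) * cnj (\<Prod>i<Suc k. b (Suc i))) = complex_of_real \<beta>"
    using arg_cong[OF prod, of cnj] by simp
  have const_prod: "(\<Prod>i<j. [:- f i:]) = [:(-1) ^ j * (\<Prod>i<j. f i):]" for f :: "nat \<Rightarrow> complex" and j
    by (induction j) (simp_all add: algebra_simps)
  have const_sign: "(-1 :: complex poly) ^ k = [:(-1) ^ k:]"
    by (induction k) auto
  have signs: "(-1::complex) ^ k * (-1) ^ k = 1"
    by (simp flip: power_mult_distrib)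
  \<comment> \<open>The number of factors is \<open>k + 3\<close>, so that negating all of them gives \<open>(-1) ^ Suc k\<close>.\<close>
  have cycles: "(-1) ^ k * ([:- b n:] * [:- b ?m:] * (\<Prod>i<Suc k. ?u i)
      + [:- cnj (b ?m):] * [:- cnj (b n):] * (\<Prod>i<Suc k. ?l i)) = - [:complex_of_real (2 * \<beta>):]"
  proof -
    have "[:- b n:] * [:- b ?m:] * (\<Prod>i<Suc k. ?u i) = [:- ((-1) ^ k * (b n * (b ?m * (\<Prod>i<Suc k. b (Suc i))))):]"
      unfolding const_prod by (simp del: prod.lessThan_Suc add: mult_ac)
    moreover have "[:- cnj (b ?m):] * [:- cnj (b n):] * (\<Prod>i<Suc k. ?l i)
        = [:- ((-1) ^ k * (cnj (b n) * (cnj (b ?m) * cnj (\<Prod>i<Suc k. b (Suc i))))):]"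
      unfolding const_prod by (simp del: prod.lessThan_Suc add: mult_ac)
    ultimately show ?thesis
      unfolding prod prod_cnj const_sign by (simp add: signs flip: mult.assoc)
  qed
  have "det (char_poly_matrix (J_mat n c b a))
       = [:- a, 1:] * det (tridiag_mat ?m ?d ?u ?l)
         - [:- b n:] * [:- cnj (b n):] * det (tridiag_mat (Suc k) (?d \<circ> Suc) (?u \<circ> Suc) (?l \<circ> Suc))
         - [:- cnj (b ?m):] * [:- b ?m:] * det (tridiag_mat (Suc k) ?d ?u ?l)
         + (-1) ^ k * ([:- b n:] * [:- b ?m:] * (\<Prod>i<Suc k. ?u i)
             + [:- cnj (b ?m):] * [:- cnj (b n):] * (\<Prod>i<Suc k. ?l i))"
    unfolding bordered by (rule det_periodic_tridiag_mat) simp_all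
  also have "[:- cnj (b ?m):] * [:- b ?m:] = [:complex_of_real ((cmod (b ?m))\<^sup>2):]"
    using const_poly_mult_cnj[of "b ?m"] by (simp only: mult.commute)
  finally show ?thesis
    unfolding char_poly_def[of "J_mat n c b a"] char_poly_jacobi_mat cycles const_poly_mult_cnj
    by (simp add: comp_def)
qed

text \<open>
  At a node \<open>s\<close>, let \<open>p\<close> and \<open>q\<close> be the values of the characteristic polynomials of the Jacobi matrix
  without its last and without its first row and column, \<open>D\<close> the derivative of its own
  characteristic polynomial, \<open>B = (cmod (b (n - 1)))\<^sup>2\<close> and \<open>A = (cmod (b n))\<^sup>2\<close>. Then minus the value of
  the characteristic polynomial of the periodic matrix is \<open>A * q + B * p + 2 * \<beta>\<close>, and the
  Casoratian gives \<open>(A * q) * (B * p) = \<beta>\<^sup>2\<close>. Hence multiplication by \<open>B * p\<close> completes the square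
  \<open>(B * p + \<beta>)\<^sup>2\<close>, while \<open>p * D > 0\<close> by the Wronskian, so the weight is nonnegative. It vanishes only for
  \<open>B * p = - \<beta>\<close>, that is, only if \<open>\<beta>\<close> and \<open>D\<close> have opposite signs.
\<close>

lemma char_poly_J_mat_eq_arrow_poly:
  fixes b :: "nat \<Rightarrow> complex"
  assumes n: "n \<ge> 3" and b: "\<And>i. i \<in> {1..n} \<Longrightarrow> b i \<noteq> 0"
    and beta: "(\<Prod>i = 1..n. b i) = complex_of_real \<beta>"
    and S: "finite S" "card S = n - 1"
    and spectrum: "spectrum (jacobi_mat (n - 1) c b) = complex_of_real ` S"
  obtains r where "char_poly (J_mat n c b a) = arrow_poly a r S"
    "\<And>s. s \<in> S \<Longrightarrow> r s \<ge> 0"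
    "\<And>s. s \<in> S \<Longrightarrow> \<beta> * (\<Prod>t\<in>S - {s}. s - t) > 0 \<Longrightarrow> r s > 0"
proof -
  obtain k where "n = 3 + k" using n le_Suc_ex by blast
  then have nk: "n = Suc (Suc (Suc k))" by simp
  let ?m = "Suc (Suc k)"
  define w where "w = (\<lambda>i. (cmod (b (Suc i)))\<^sup>2)"
  define P where "P = jacobi_poly (c \<circ> Suc) w"
  define p where "p s = poly (P (Suc k)) s" for s
  define q where "q s = poly (jacobi_poly (c \<circ> Suc \<circ> Suc) (w \<circ> Suc) (Suc k)) s" for s
  define D where "D s = (\<Prod>t\<in>S - {s}. s - t)" for s
  define A where "A = (cmod (b n))\<^sup>2"
  define B where "B = (cmod (b ?m))\<^sup>2"
  \<comment> \<open>The quotient of \<open>A * q s + B * p s + 2 * \<beta>\<close> by \<open>D s\<close>, written so that its sign is visible.\<close>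
  define r where "r s = (B * p s + \<beta>)\<^sup>2 / (B * (p s * D s))" for s

  have w_pos: "w i > 0" if "i < n" for i
    using b[of "Suc i"] that by (auto simp: w_def)
  have B_pos: "B > 0" using w_pos[of "Suc k"] by (simp add: w_def B_def nk)

  have char_jacobi: "char_poly (jacobi_mat ?m c b) = node_poly S"
  proof (rule poly_eqI_degree_lead_coeff[where n = ?m and A = "complex_of_real ` S"])
    have "lead_coeff (node_poly S) = 1"
      by (simp add: node_poly_def lead_coeff_prod)
    then show "poly.coeff (char_poly (jacobi_mat ?m c b)) ?m = poly.coeff (node_poly S) ?m"
      using degree_monic_char_poly[OF jacobi_mat_carrier, of ?m c b] S by (simp add: nk)
    fix z assume z: "z \<in> complex_of_real ` S"
    then have "poly (char_poly (jacobi_mat ?m c b)) z = 0"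
      using spectrum spectrum_root_char_poly[OF jacobi_mat_carrier, of ?m c b] by (auto simp: nk)
    then show "poly (char_poly (jacobi_mat ?m c b)) z = poly (node_poly S) z"
      using z S by (auto simp: poly_node_poly)
  qed (use S degree_monic_char_poly[OF jacobi_mat_carrier, of ?m c b] in
        \<open>auto simp: card_image inj_on_def nk\<close>)
  have P: "P ?m = (\<Prod>s\<in>S. [:- s, 1:])"
  proof -
    have "poly (P ?m) x = poly (\<Prod>s\<in>S. [:- s, 1:]) x" for x
    proof -
      have "complex_of_real (poly (P ?m) x) = poly (node_poly S) (complex_of_real x)"
        unfolding char_jacobi[symmetric] poly_char_poly_jacobi_mat P_def w_def ..
      also have "\<dots> = complex_of_real (poly (\<Prod>s\<in>S. [:- s, 1:]) x)"
        by (simp add: poly_node_poly poly_prod)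
      finally show ?thesis by (simp only: of_real_eq_iff)
    qed
    then show ?thesis by (simp flip: poly_eq_poly_eq_iff add: fun_eq_iff)
  qed
  have P_zero: "poly (P ?m) s = 0" if "s \<in> S" for s
    using that S by (auto simp: P poly_prod)
  have P_deriv: "poly (pderiv (P ?m)) s = D s" if "s \<in> S" for s
  proof -
    have "P ?m = [:- s, 1:] * (\<Prod>t\<in>S - {s}. [:- t, 1:])"
      using that S by (simp add: P prod.remove del: mult_pCons_left)
    then show ?thesis
      by (simp add: pderiv_mult pderiv_pCons D_def poly_prod del: mult_pCons_left)
  qed

  have pD: "p s * D s > 0" if "s \<in> S" for s
    using jacobi_poly_wronskian_pos[of "Suc k" w "c \<circ> Suc" s] w_pos P_zero[OF that] P_deriv[OF that]
    by (simp add: p_def nk mult.commute flip: P_def)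
  have qp: "q s * p s = (\<Prod>i<Suc k. w i)" if "s \<in> S" for s
    using arg_cong[OF jacobi_poly_casoratian[of "c \<circ> Suc" w k], of "\<lambda>f. poly f s"] P_zero[OF that]
    unfolding P_def[symmetric] p_def q_def by (simp del: jacobi_poly.simps prod.lessThan_Suc)
  have beta_sq: "\<beta>\<^sup>2 = A * B * (\<Prod>i<Suc k. w i)"
  proof -
    have "\<beta>\<^sup>2 = (cmod (\<Prod>i = 1..n. b i))\<^sup>2" unfolding beta by simp
    also have "\<dots> = (\<Prod>i = 1..n. (cmod (b i))\<^sup>2)"
      by (simp add: prod_norm[symmetric] prod_power_distrib)
    also have "\<dots> = (\<Prod>i<n. w i)"
      unfolding w_def by (intro prod.reindex_bij_witness[of _ Suc "\<lambda>i. i - 1"]) auto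
    finally show ?thesis by (simp add: nk A_def B_def w_def mult_ac)
  qed

  have rD: "r s * D s = A * q s + B * p s + 2 * \<beta>" if "s \<in> S" for s
  proof -
    have nz: "p s \<noteq> 0" "D s \<noteq> 0" "B \<noteq> 0" using pD[OF that] B_pos by auto
    have "(B * p s + \<beta>)\<^sup>2 = (A * q s + B * p s + 2 * \<beta>) * (B * p s)"
      using beta_sq qp[OF that] by (simp add: power2_eq_square algebra_simps)
    then show ?thesis using nz by (simp add: r_def field_simps)
  qed

  have char_J: "char_poly (J_mat n c b a) = [:- a, 1:] * node_poly S
      - [:complex_of_real A:] * char_poly (jacobi_mat (Suc k) (c \<circ> Suc) (b \<circ> Suc))
      - [:complex_of_real B:] * char_poly (jacobi_mat (Suc k) c b)
      - [:complex_of_real (2 * \<beta>):]"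
    unfolding A_def B_def char_jacobi[symmetric] nk
    by (rule char_poly_J_mat) (use beta nk in simp)
  have "char_poly (J_mat n c b a) = arrow_poly a r S"
  proof (rule eq_arrow_polyI)
    have "degree ([:- a, 1:] * node_poly S - char_poly (J_mat n c b a)) \<le> Suc k"
      unfolding char_J using degree_monic_char_poly[OF jacobi_mat_carrier, of "Suc k"]
      by (auto intro!: degree_add_le order.trans[OF degree_smult_le])
    then show "degree (char_poly (J_mat n c b a) - [:- a, 1:] * node_poly S) < card S"
      using S degree_minus[of "[:- a, 1:] * node_poly S - char_poly (J_mat n c b a)"] by (simp add: nk)
  next
    fix s assume s: "s \<in> S"
    have "poly (node_poly S) (complex_of_real s) = 0"
      using s S by (auto simp: poly_node_poly)
    then have "poly (char_poly (J_mat n c b a)) (complex_of_real s)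
        = complex_of_real (- (A * q s + B * p s + 2 * \<beta>))"
      unfolding char_J
      by (simp add: poly_char_poly_jacobi_mat p_def q_def P_def w_def comp_def del: jacobi_poly.simps)
    then show "poly (char_poly (J_mat n c b a)) (complex_of_real s)
        = complex_of_real (- r s * (\<Prod>t\<in>S - {s}. s - t))"
      using rD[OF s] by (simp only: D_def mult_minus_left)
  qed (use S in simp)
  moreover have "r s \<ge> 0" if "s \<in> S" for s
    using pD[OF that] B_pos by (simp add: r_def)
  moreover have "r s > 0" if "s \<in> S" "\<beta> * D s > 0" for s
  proof -
    have "p s * \<beta> > 0"
      using pD[OF that(1)] that(2) by (auto simp: zero_less_mult_iff)
    moreover have "B * (p s)\<^sup>2 \<ge> 0" using B_pos by simp
    ultimately have "p s * (B * p s + \<beta>) > 0"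
      by (simp add: power2_eq_square algebra_simps)
    then have "B * p s + \<beta> \<noteq> 0" by auto
    then show ?thesis using pD[OF that(1)] B_pos by (simp add: r_def)
  qed
  ultimately show thesis
    using that unfolding D_def by blast
qed

section \<open>Signs, location of eigenvalues and interlacing\<close>

lemma sign_prod_differences:
  fixes \<mu> :: "nat \<Rightarrow> real"
  assumes mono: "strict_mono_on {1..m} \<mu>" and k: "k \<in> {1..m}"
  shows "(-1) ^ (m - k) * (\<Prod>t\<in>\<mu> ` {1..m} - {\<mu> k}. \<mu> k - t) > 0"
proof -
  have inj: "inj_on \<mu> {1..m}"
    using mono by (rule strict_mono_on_imp_inj_on)
  have square_sign: "(-1) ^ j * (x * ((-1) ^ j * y)) = x * y" for x y :: real and j :: nat
  proof -
    have "(-1) ^ j * (x * ((-1) ^ j * y)) = ((-1) ^ j * (-1) ^ j) * (x * y)"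
      by (simp only: mult_ac)
    also have "(-1::real) ^ j * (-1) ^ j = 1"
      by (simp flip: power_mult_distrib)
    finally show ?thesis by simp
  qed
  have "\<mu> ` {1..m} - {\<mu> k} = \<mu> ` ({1..m} - {k})"
    using inj_on_image_set_diff[OF inj, of "{1..m}" "{k}"] k by auto
  then have "(\<Prod>t\<in>\<mu> ` {1..m} - {\<mu> k}. \<mu> k - t) = (\<Prod>j\<in>{1..m} - {k}. \<mu> k - \<mu> j)"
    using inj by (simp add: prod.reindex inj_on_diff)
  also have "{1..m} - {k} = {1..<k} \<union> {k<..m}"
    using k by auto
  also have "(\<Prod>j\<in>{1..<k} \<union> {k<..m}. \<mu> k - \<mu> j)
      = (\<Prod>j\<in>{1..<k}. \<mu> k - \<mu> j) * (\<Prod>j\<in>{k<..m}. (-1) * (\<mu> j - \<mu> k))"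
    by (subst prod.union_disjoint) auto
  also have "(\<Prod>j\<in>{k<..m}. (-1) * (\<mu> j - \<mu> k)) = (-1) ^ (m - k) * (\<Prod>j\<in>{k<..m}. \<mu> j - \<mu> k)"
    by (simp only: prod.distrib prod_constant card_greaterThanAtMost)
  finally have "(-1) ^ (m - k) * (\<Prod>t\<in>\<mu> ` {1..m} - {\<mu> k}. \<mu> k - t)
      = (\<Prod>j\<in>{1..<k}. \<mu> k - \<mu> j) * (\<Prod>j\<in>{k<..m}. \<mu> j - \<mu> k)"
    by (simp only: square_sign)
  also have "\<dots> > 0"
    using k by (intro mult_pos_pos prod_pos) (auto intro!: strict_mono_onD[OF mono])
  finally show ?thesis .
qed

text \<open>
  If \<open>\<Lambda> k\<close> exceeded \<open>\<mu> k\<close>, the half-line above \<open>\<mu> k\<close> would contain the \<open>m + 2 - k\<close> roots from \<open>\<Lambda> k\<close>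
  on, but only \<open>m - k\<close> nodes; the other inequality is the same count below \<open>\<mu> k\<close>.
\<close>

lemma arrow_poly_weak_interlacing:
  fixes \<mu> \<Lambda> :: "nat \<Rightarrow> real"
  assumes a: "a \<in> \<real>" and mu: "strict_mono_on {1..m} \<mu>"
    and nonneg: "\<And>s. s \<in> \<mu> ` {1..m} \<Longrightarrow> r s \<ge> 0"
    and Lambda: "mono_on {1..Suc m} \<Lambda>"
    and roots: "proots (arrow_poly a r (\<mu> ` {1..m})) = image_mset (\<lambda>k. complex_of_real (\<Lambda> k)) (mset_set {1..Suc m})"
    and k: "k \<in> {1..m}"
  shows "\<Lambda> k \<le> \<mu> k" and "\<mu> k \<le> \<Lambda> (Suc k)"
proof -
  have count: "card {i\<in>{1..Suc m}. \<Lambda> i \<in> I} \<le> Suc (card {i\<in>{1..m}. \<mu> i \<in> I})"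
    if "\<And>x y. x \<in> I \<Longrightarrow> y \<in> I \<Longrightarrow> {x<..<y} \<subseteq> I" for I
  proof -
    have "card {i\<in>{1..Suc m}. \<Lambda> i \<in> I} \<le> Suc (card (\<mu> ` {1..m} \<inter> I))"
      using arrow_poly_root_count[where r = r and S = "\<mu> ` {1..m}" and I = I, OF _ a nonneg that]
      unfolding roots by (simp add: filter_mset_image_mset filter_mset_mset_set)
    also have "\<mu> ` {1..m} \<inter> I = \<mu> ` {i\<in>{1..m}. \<mu> i \<in> I}" by auto
    also have "card \<dots> \<le> card {i\<in>{1..m}. \<mu> i \<in> I}" by (rule card_image_le) simp
    finally show ?thesis by simp
  qed
  show "\<Lambda> k \<le> \<mu> k"
  proof (rule ccontr)
    assume "\<not> ?thesis"
    then have "\<mu> k < \<Lambda> i" if "i \<in> {k..Suc m}" for i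
      using mono_onD[OF Lambda, of k i] k that by simp
    then have "{k..Suc m} \<subseteq> {i\<in>{1..Suc m}. \<Lambda> i \<in> {\<mu> k<..}}"
      using k by auto
    then have "card {k..Suc m} \<le> card {i\<in>{1..Suc m}. \<Lambda> i \<in> {\<mu> k<..}}"
      by (rule card_mono[rotated]) simp
    also have "\<dots> \<le> Suc (card {i\<in>{1..m}. \<mu> i \<in> {\<mu> k<..}})" by (rule count) auto
    also have "card {i\<in>{1..m}. \<mu> i \<in> {\<mu> k<..}} \<le> card {Suc k..m}"
    proof (intro card_mono subsetI)
      fix i assume "i \<in> {i\<in>{1..m}. \<mu> i \<in> {\<mu> k<..}}"
      then show "i \<in> {Suc k..m}"
        using k strict_mono_on_leD[OF mu, of i k] by (cases "i \<le> k") auto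
    qed simp
    finally have "card {k..Suc m} \<le> Suc (card {Suc k..m})" by simp
    then show False using k by (simp add: Suc_diff_le)
  qed
  show "\<mu> k \<le> \<Lambda> (Suc k)"
  proof (rule ccontr)
    assume "\<not> ?thesis"
    then have "\<Lambda> i < \<mu> k" if "i \<in> {1..Suc k}" for i
      using mono_onD[OF Lambda, of i "Suc k"] k that by simp
    then have "{1..Suc k} \<subseteq> {i\<in>{1..Suc m}. \<Lambda> i \<in> {..<\<mu> k}}"
      using k by auto
    then have "card {1..Suc k} \<le> card {i\<in>{1..Suc m}. \<Lambda> i \<in> {..<\<mu> k}}"
      by (rule card_mono[rotated]) simp
    also have "\<dots> \<le> Suc (card {i\<in>{1..m}. \<mu> i \<in> {..<\<mu> k}})" by (rule count) auto
    also have "card {i\<in>{1..m}. \<mu> i \<in> {..<\<mu> k}} \<le> card {1..<k}"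
    proof (intro card_mono subsetI)
      fix i assume "i \<in> {i\<in>{1..m}. \<mu> i \<in> {..<\<mu> k}}"
      then show "i \<in> {1..<k}"
        using k strict_mono_on_leD[OF mu, of k i] by (cases "k \<le> i") auto
    qed simp
    finally show False using k by (cases k) auto
  qed
qed

theorem theorem3p2:
  fixes n :: nat and c :: "nat \<Rightarrow> real" and b :: "nat \<Rightarrow> complex" and a :: complex
    and J J' :: "complex mat" and \<mu> :: "nat \<Rightarrow> real" and \<beta> :: real
  assumes n: "n \<ge> 3"
    and b: "\<And>k. k \<in> {1..n} \<Longrightarrow> b k \<noteq> 0"
    and J: "J = J_mat n c b a"
    and J': "J' = leading_principal_submatrix (n - 1) J"
    and mu_mono: "strict_mono_on {1..n - 1} \<mu>"
    and mu_spectrum: "spectrum J' = (\<lambda>k. complex_of_real (\<mu> k)) ` {1..n - 1}"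
    and beta: "(\<Prod>k = 1..n. b k) = complex_of_real \<beta>"
  shows
    "(a \<in> \<real> \<longrightarrow>
        (\<forall>z. eigenvalue J z \<longrightarrow>
           z \<in> \<real> \<and> eigenvalue_mult J z \<le> 2 \<and>
           (eigenvalue_mult J z \<ge> 2 \<longrightarrow> eigenvalue J' z)))
     \<and>
     (a \<notin> \<real> \<longrightarrow>
        (Im a > 0 \<longrightarrow> (\<forall>z. eigenvalue J z \<longrightarrow> Im z \<ge> 0)) \<and>
        (Im a < 0 \<longrightarrow> (\<forall>z. eigenvalue J z \<longrightarrow> Im z \<le> 0)) \<and>
        (\<forall>z. eigenvalue J z \<longrightarrow> (z \<in> \<real> \<longleftrightarrow> eigenvalue J' z)))
     \<and>
     (a \<in> \<real> \<longrightarrow>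
        (\<forall>\<Lambda> :: nat \<Rightarrow> real.
           mono_on {1..n} \<Lambda> \<and>
           proots (char_poly J) = image_mset (\<lambda>k. complex_of_real (\<Lambda> k)) (mset_set {1..n}) \<longrightarrow>
           (\<forall>k\<in>{1..n - 1}.
              (\<beta> > 0 \<longrightarrow>
                 (odd (n - k) \<longrightarrow> \<Lambda> k < \<mu> k \<and> \<mu> k < \<Lambda> (k + 1)) \<and>
                 (even (n - k) \<longrightarrow> \<Lambda> k \<le> \<mu> k \<and> \<mu> k \<le> \<Lambda> (k + 1))) \<and>
              (\<beta> < 0 \<longrightarrow>
                 (odd (n - k) \<longrightarrow> \<Lambda> k \<le> \<mu> k \<and> \<mu> k \<le> \<Lambda> (k + 1)) \<and>
                 (even (n - k) \<longrightarrow> \<Lambda> k < \<mu> k \<and> \<mu> k < \<Lambda> (k + 1))))))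
     \<and>
     (\<forall>k\<in>{1..n - 1}.
        poly (char_poly J) (complex_of_real (\<mu> k)) \<in> \<real> \<and>
        (\<beta> > 0 \<longrightarrow>
           (odd (n - k) \<longrightarrow> (-1) ^ (n - k) * Re (poly (char_poly J) (complex_of_real (\<mu> k))) > 0) \<and>
           (even (n - k) \<longrightarrow> (-1) ^ (n - k) * Re (poly (char_poly J) (complex_of_real (\<mu> k))) \<ge> 0)) \<and>
        (\<beta> < 0 \<longrightarrow>
           (odd (n - k) \<longrightarrow> (-1) ^ (n - k) * Re (poly (char_poly J) (complex_of_real (\<mu> k))) \<ge> 0) \<and>
           (even (n - k) \<longrightarrow> (-1) ^ (n - k) * Re (poly (char_poly J) (complex_of_real (\<mu> k))) > 0)))"
proof -
  define S where "S = \<mu> ` {1..n - 1}"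
  have S: "finite S" "card S = n - 1"
    using strict_mono_on_imp_inj_on[OF mu_mono] by (auto simp: S_def card_image)
  have nS: "n = Suc (n - 1)" using n by simp
  have J'_jacobi: "J' = jacobi_mat (n - 1) c b"
    using leading_principal_submatrix_J_mat[of "n - 1" c b a] nS by (simp add: J J')
  have spec: "spectrum J' = complex_of_real ` S"
    unfolding mu_spectrum S_def by auto
  obtain r where char_J: "char_poly J = arrow_poly a r S"
    and r_nonneg: "\<And>s. s \<in> S \<Longrightarrow> r s \<ge> 0"
    and r_pos: "\<And>s. s \<in> S \<Longrightarrow> \<beta> * (\<Prod>t\<in>S - {s}. s - t) > 0 \<Longrightarrow> r s > 0"
    using char_poly_J_mat_eq_arrow_poly[OF n b beta S spec[unfolded J'_jacobi], of a] unfolding J by blast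
  have eig_J: "eigenvalue J z \<longleftrightarrow> poly (arrow_poly a r S) z = 0" for z
    using eigenvalue_root_char_poly[OF J_mat_carrier] char_J unfolding J by simp
  have eig_J': "eigenvalue J' z \<longleftrightarrow> z \<in> complex_of_real ` S" for z
    using spec unfolding spectrum_def by blast
  have Im_eig: "sgn (Im z) = sgn (Im a)" if "eigenvalue J z" "\<not> eigenvalue J' z" for z
  proof -
    let ?t = "1 + (\<Sum>s\<in>S. r s / (cmod (z - complex_of_real s))\<^sup>2)"
    have "Im z * ?t = Im a"
      using Im_arrow_poly_root[OF S(1)] that unfolding eig_J eig_J' by blast
    then have "sgn (Im a) = sgn (Im z) * sgn ?t"
      by (metis sgn_mult)
    moreover have "?t > 0"
      using r_nonneg by (intro add_pos_nonneg sum_nonneg) auto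
    ultimately show ?thesis by simp
  qed
  have real_J': "Im z = 0" if "eigenvalue J' z" for z
    using that unfolding eig_J' by auto

  define D where "D k = (\<Prod>t\<in>S - {\<mu> k}. \<mu> k - t)" for k
  have D_sign: "(-1) ^ (n - 1 - k) * D k > 0" if "k \<in> {1..n - 1}" for k
    using sign_prod_differences[OF mu_mono that] by (simp add: D_def S_def)
  have node_value: "poly (char_poly J) (complex_of_real (\<mu> k)) = complex_of_real (- r (\<mu> k) * D k)"
    if "k \<in> {1..n - 1}" for k
    unfolding char_J D_def using that by (intro poly_arrow_poly_at_node S) (auto simp: S_def)
  have sign_flip: "(-1) ^ (n - k) = - ((-1) ^ (n - 1 - k) :: real)" if "k \<in> {1..n - 1}" for k
  proof -
    have "n - k = Suc (n - 1 - k)" using that by auto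
    then show ?thesis by simp
  qed
  have signed_value: "(-1) ^ (n - k) * Re (poly (char_poly J) (complex_of_real (\<mu> k)))
      = r (\<mu> k) * ((-1) ^ (n - 1 - k) * D k)" if "k \<in> {1..n - 1}" for k
    unfolding node_value[OF that] sign_flip[OF that] by simp
  have signed_nonneg: "(-1) ^ (n - k) * Re (poly (char_poly J) (complex_of_real (\<mu> k))) \<ge> 0"
    if "k \<in> {1..n - 1}" for k
    unfolding signed_value[OF that] using D_sign[OF that] r_nonneg[of "\<mu> k"] that
    by (intro mult_nonneg_nonneg less_imp_le[OF D_sign]) (auto simp: S_def)
  \<comment> \<open>The sign of \<open>D k\<close> is \<open>(-1) ^ (n - 1 - k)\<close>, so the parity condition says exactly that \<open>\<beta> * D k > 0\<close>.\<close>
  have signed_pos: "(-1) ^ (n - k) * Re (poly (char_poly J) (complex_of_real (\<mu> k))) > 0"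
    if k: "k \<in> {1..n - 1}" and strict: "\<beta> > 0 \<and> odd (n - k) \<or> \<beta> < 0 \<and> even (n - k)" for k
  proof -
    have "n - k = Suc (n - 1 - k)" using k by auto
    then have "\<beta> * D k > 0"
      using D_sign[OF k] strict by (auto simp: zero_less_mult_iff)
    then have "r (\<mu> k) > 0"
      using r_pos[of "\<mu> k"] k by (auto simp: D_def S_def)
    then show ?thesis
      unfolding signed_value[OF k] using D_sign[OF k] by (rule mult_pos_pos)
  qed

  have part1: "z \<in> \<real> \<and> eigenvalue_mult J z \<le> 2 \<and> (eigenvalue_mult J z \<ge> 2 \<longrightarrow> eigenvalue J' z)"
    if a: "a \<in> \<real>" and z: "eigenvalue J z" for z
  proof -
    have "Im z = 0"
      using Im_eig[OF z] real_J'[of z] a by (cases "eigenvalue J' z") (auto simp: complex_is_Real_iff sgn_0_0)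
    moreover have "eigenvalue_mult J z \<le> 1 + (if eigenvalue J' z then 1 else 0)"
      unfolding eigenvalue_mult_def char_J eig_J' by (rule arrow_poly_order[OF S(1) a r_nonneg])
    ultimately show ?thesis
      by (auto simp: complex_is_Real_iff split: if_splits)
  qed
  have part2: "(Im a > 0 \<longrightarrow> (\<forall>z. eigenvalue J z \<longrightarrow> Im z \<ge> 0)) \<and>
        (Im a < 0 \<longrightarrow> (\<forall>z. eigenvalue J z \<longrightarrow> Im z \<le> 0)) \<and>
        (\<forall>z. eigenvalue J z \<longrightarrow> (z \<in> \<real> \<longleftrightarrow> eigenvalue J' z))" if a: "a \<notin> \<real>"
  proof (intro conjI impI allI)
    fix z assume "Im a > 0" and z: "eigenvalue J z"
    then show "Im z \<ge> 0"
      using Im_eig[OF z] real_J'[of z] by (cases "eigenvalue J' z") (auto simp: sgn_1_pos)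
  next
    fix z assume "Im a < 0" and z: "eigenvalue J z"
    then show "Im z \<le> 0"
      using Im_eig[OF z] real_J'[of z] by (cases "eigenvalue J' z") (auto simp: sgn_1_neg)
  next
    fix z assume z: "eigenvalue J z"
    then show "z \<in> \<real> \<longleftrightarrow> eigenvalue J' z"
      using Im_eig[OF z] real_J'[of z] a
      by (cases "eigenvalue J' z") (auto simp: complex_is_Real_iff sgn_0_0)
  qed
  \<comment> \<open>Interlacing is strict at a node that is not a root.\<close>
  have part3: "\<Lambda> k \<le> \<mu> k \<and> \<mu> k \<le> \<Lambda> (k + 1) \<and>
      (\<beta> > 0 \<and> odd (n - k) \<or> \<beta> < 0 \<and> even (n - k) \<longrightarrow> \<Lambda> k < \<mu> k \<and> \<mu> k < \<Lambda> (k + 1))"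
    if a: "a \<in> \<real>" and Lambda: "mono_on {1..n} \<Lambda>"
      and roots: "proots (char_poly J) = image_mset (\<lambda>k. complex_of_real (\<Lambda> k)) (mset_set {1..n})"
      and k: "k \<in> {1..n - 1}" for \<Lambda> :: "nat \<Rightarrow> real" and k
  proof -
    have weak: "\<Lambda> k \<le> \<mu> k" "\<mu> k \<le> \<Lambda> (k + 1)"
      using arrow_poly_weak_interlacing[OF a mu_mono _ _ _ k, of r \<Lambda>] r_nonneg Lambda roots nS
      unfolding char_J S_def by auto
    have root: "poly (char_poly J) (complex_of_real (\<Lambda> i)) = 0" if "i \<in> {1..n}" for i
    proof -
      have "char_poly J \<noteq> 0" unfolding char_J by (rule arrow_poly_nonzero[OF S(1)])
      then have "{z. poly (char_poly J) z = 0} = set_mset (proots (char_poly J))" by simp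
      also have "\<dots> = (\<lambda>k. complex_of_real (\<Lambda> k)) ` {1..n}" unfolding roots by simp
      finally show ?thesis using that by blast
    qed
    have "\<Lambda> k \<noteq> \<mu> k \<and> \<Lambda> (k + 1) \<noteq> \<mu> k"
      if "\<beta> > 0 \<and> odd (n - k) \<or> \<beta> < 0 \<and> even (n - k)"
      using signed_pos[OF k that] root[of k] root[of "k + 1"] k by auto
    with weak show ?thesis by fastforce
  qed
  have part4_real: "poly (char_poly J) (complex_of_real (\<mu> k)) \<in> \<real>" if "k \<in> {1..n - 1}" for k
    unfolding node_value[OF that] by (rule Reals_of_real)
  show ?thesis
    using part1 part2 part3 part4_real signed_nonneg signed_pos by blast
qed

end
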